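(* Let $\theta=\phi(D)$ be a delta operator with poweroids $x^{\{n\}}$. For every formal power series $f$ and every integer $n\ge 1$, $$f(D)\,0^{\{n\}}=\frac{df(D)}{d\theta}\,0^{\{n-1\}}=\cdots=\frac{d^nf(D)}{d\theta^n}\,0^{\{0\}},$$ that is, $f(D)\,0^{\{n\}}=\frac{d^jf(D)}{d\theta^j}\,0^{\{n-j\}}$ for all $0\le j\le n$.
   Context: Work with polynomials in $x$ (real or complex coefficients); $D=d/dx$. A delta operator is $\theta=\phi(D)$, where $\phi(t)=\sum_{\nu\ge1}k_\nu t^\nu$ is a formal power series with $k_1=1$. Its poweroids $x^{\{n\}}$, $n=0,1,2,\dots$, are the unique polynomials with $x^{\{0\}}=1$, $\theta x^{\{n\}}=n\,x^{\{n-1\}}$ for $n\ge1$, and $x^{\{n\}}|_{x=0}=0$ for $n\ge1$. For a formal power series $f$, $f(D)\,0^{\{n\}}$ denotes $\big(f(D)x^{\{n\}}\big)\big|_{x=0}$. The derivative $\frac{d^jf(D)}{d\theta^j}$ means: regard $f(D)=f(\phi^{-1}(\theta))$ as a formal power series in $\theta$ ($\phi^{-1}$ being the compositional inverse of $\phi$), differentiate $j$ times with respect to $\theta$, and regard the result again as a power series in $D$; e.g. $\frac{df(D)}{d\theta}=f'(D)/\phi'(D)$. *)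

theory Defs
  imports "HOL-Computational_Algebra.Computational_Algebra"
begin

text \<open>The action of \<open>f(D)\<close>, \<open>D = d/dx\<close>, on a polynomial \<open>p\<close>. The formally infinite series
  \<open>\<Sum>k. f $ k * D^k p\<close> may be cut off at \<open>degree p\<close>, since \<open>D^k p = 0\<close> beyond that
  (lemma \<open>fps_op_upto\<close>).\<close>

definition fps_op :: "'a::field_char_0 fps \<Rightarrow> 'a poly \<Rightarrow> 'a poly" where
  "fps_op f p = (\<Sum>k\<le>degree p. smult (f $ k) ((pderiv ^^ k) p))"

definition delta_series :: "'a::field_char_0 fps \<Rightarrow> bool" where
  "delta_series \<phi> \<longleftrightarrow> \<phi> $ 0 = 0 \<and> \<phi> $ 1 = 1"

text \<open>\<open>u n\<close> is the poweroid \<open>x^{n}\<close> of \<open>\<theta> = \<phi>(D)\<close>. Existence and uniqueness of the sequence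
  is lemma \<open>ex1_poweroids\<close>.\<close>

definition poweroids :: "'a::field_char_0 fps \<Rightarrow> (nat \<Rightarrow> 'a poly) \<Rightarrow> bool" where
  "poweroids \<phi> u \<longleftrightarrow>
     u 0 = 1 \<and>
     (\<forall>n\<ge>1. fps_op \<phi> (u n) = smult (of_nat n) (u (n - 1))) \<and>
     (\<forall>n\<ge>1. poly (u n) 0 = 0)"

text \<open>The \<open>j\<close>-th derivative of \<open>f(D)\<close> with respect to \<open>\<theta>\<close>: express \<open>f\<close> in the variable \<open>\<theta>\<close>,
  differentiate \<open>j\<close> times in \<open>\<theta>\<close>, and substitute \<open>\<theta> = \<phi>(D)\<close> back. \<open>fps_inv \<phi>\<close> is the compositional
  inverse of \<open>\<phi>\<close>.\<close>

definition theta_deriv :: "'a::field_char_0 fps \<Rightarrow> nat \<Rightarrow> 'a fps \<Rightarrow> 'a fps" where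
  "theta_deriv \<phi> j f = fps_nth_deriv j (f oo fps_inv \<phi>) oo \<phi>"

lemma higher_pderiv_eq_0:
  fixes p :: "'a::field_char_0 poly"
  assumes "k > degree p"
  shows "(pderiv ^^ k) p = 0"
proof (rule poly_eqI)
  fix n
  have "coeff p (n + k) = 0" using assms by (intro coeff_eq_0) simp
  then show "coeff ((pderiv ^^ k) p) n = coeff 0 n" by (simp add: coeff_higher_pderiv)
qed

lemma fps_op_upto:
  assumes "degree p \<le> N"
  shows "fps_op f p = (\<Sum>k\<le>N. smult (f $ k) ((pderiv ^^ k) p))"
  unfolding fps_op_def
  by (rule sum.mono_neutral_left) (use assms in \<open>auto simp: higher_pderiv_eq_0\<close>)

lemma degree_higher_pderiv_le: "degree ((pderiv ^^ k) (p::'a::field_char_0 poly)) \<le> degree p"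
  by (induction k) (auto simp: degree_pderiv intro: diff_le_self order.trans)

lemma degree_fps_op_le: "degree (fps_op f p) \<le> degree p"
  unfolding fps_op_def
  by (intro degree_sum_le finite_atMost order.trans[OF degree_smult_le degree_higher_pderiv_le])

lemma fps_op_add: "fps_op f (p + q) = fps_op f p + fps_op f q"
proof -
  let ?N = "max (degree p) (degree q)"
  have "degree (p + q) \<le> ?N" by (rule degree_add_le_max)
  then show ?thesis
    by (simp add: fps_op_upto[of _ ?N] higher_pderiv_add smult_add_right sum.distrib)
qed

lemma smult_sum_right:
  "smult c (\<Sum>i\<in>A. g i) = (\<Sum>i\<in>A. smult c (g i :: 'a::comm_semiring_0 poly))"
  by (induction A rule: infinite_finite_induct) (auto simp: smult_add_right)

lemma fps_op_smult: "fps_op f (smult c p) = smult c (fps_op f p)"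
  by (simp add: fps_op_upto[of _ "degree p"] degree_smult_le higher_pderiv_smult
      smult_sum_right mult.commute)

lemma fps_op_diff: "fps_op f (p - q) = fps_op f p - fps_op f q"
  using fps_op_add[of f "p - q" q] by simp

lemma fps_op_1 [simp]: "fps_op 1 p = p"
proof -
  have "fps_op 1 p = (\<Sum>k\<le>degree p. if k = 0 then p else 0)"
    unfolding fps_op_def by (intro sum.cong) auto
  then show ?thesis by simp
qed

lemma fps_op_X [simp]: "fps_op fps_X p = pderiv p"
proof -
  have "fps_op fps_X p = (\<Sum>k\<le>Suc (degree p). if k = 1 then pderiv p else 0)"
    unfolding fps_op_upto[of p "Suc (degree p)", OF le_SucI[OF order_refl]]
    by (intro sum.cong) auto
  then show ?thesis by simp
qed

lemma fps_op_mult: "fps_op (f * g) p = fps_op f (fps_op g p)"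
proof -
  let ?N = "degree p"
  let ?h = "\<lambda>i j. smult (f $ i * g $ j) ((pderiv ^^ (i + j)) p)"
  have z: "i + j \<le> ?N" if "(pderiv ^^ (i + j)) p \<noteq> 0" for i j
    using higher_pderiv_eq_0 that by (meson not_le)
  have "fps_op (f * g) p = (\<Sum>k\<le>?N. \<Sum>i\<le>k. ?h i (k - i))"
    unfolding fps_op_def
    by (intro sum.cong refl) (auto simp: fps_mult_nth smult_sum atLeast0AtMost)
  also have "\<dots> = (\<Sum>(i,j)\<in>{(i,j). i + j \<le> ?N}. ?h i j)"
    by (rule sum.triangle_reindex_eq[symmetric])
  also have "\<dots> = (\<Sum>(i,j)\<in>{..?N} \<times> {..?N}. ?h i j)"
    by (rule sum.mono_neutral_left) (auto intro: z)
  also have "\<dots> = (\<Sum>i\<le>?N. \<Sum>j\<le>?N. ?h i j)"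
    by (simp add: sum.cartesian_product)
  also have "\<dots> = fps_op f (fps_op g p)"
    unfolding fps_op_upto[OF degree_fps_op_le] unfolding fps_op_def
    by (intro sum.cong refl) (simp add: higher_pderiv_sum higher_pderiv_smult smult_sum_right funpow_add)
  finally show ?thesis .
qed

lemma ex_pderiv: "\<exists>q. pderiv q = (p::'a::field_char_0 poly) \<and> poly q 0 = 0"
proof -
  let ?q = "\<Sum>i\<le>degree p. monom (coeff p i / of_nat (Suc i)) (Suc i)"
  have "pderiv ?q = (\<Sum>i\<le>degree p. monom (coeff p i) i)"
    by (simp add: higher_pderiv_sum[of 1, simplified] pderiv_monom del: of_nat_Suc)
  then have "pderiv ?q = p" by (simp add: poly_as_sum_of_monoms)
  moreover have "poly ?q 0 = 0" by (simp add: poly_sum poly_monom)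
  ultimately show ?thesis by blast
qed

lemma ex1_fps_op:
  assumes "delta_series \<phi>"
  shows "\<exists>!q. fps_op \<phi> q = p \<and> poly q 0 = 0"
proof -
  define g where "g = fps_shift 1 \<phi>"
  have \<phi>: "\<phi> = g * fps_X"
    using assms by (auto simp: fps_eq_iff g_def delta_series_def)
  have g0: "g $ 0 \<noteq> 0" using assms by (simp add: g_def delta_series_def)
  have inv: "g * inverse g = 1" "inverse g * g = 1"
    using g0 by (simp_all add: inverse_mult_eq_1 inverse_mult_eq_1')
  have iff: "fps_op \<phi> q = p \<longleftrightarrow> pderiv q = fps_op (inverse g) p" for q
    unfolding \<phi> fps_op_mult fps_op_X by (metis inv fps_op_1 fps_op_mult)
  have uniq: "q = r" if "pderiv q = pderiv r" "poly q 0 = 0" "poly r 0 = 0" for q r :: "'a poly"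
  proof -
    have "pderiv (q - r) = 0" using that by (simp add: pderiv_diff)
    then obtain c where "q - r = [:c:]" by (metis pderiv_eq_0_iff degree_eq_zeroE)
    then show ?thesis using that by (metis diff_eq_eq poly_diff diff_self add_0 pCons_0_0 poly_const_conv)
  qed
  show ?thesis unfolding iff using ex_pderiv uniq by metis
qed

lemma ex1_poweroids:
  assumes "delta_series \<phi>"
  shows "\<exists>!u. poweroids \<phi> u"
proof -
  define S where "S p = (THE q. fps_op \<phi> q = p \<and> poly q 0 = 0)" for p
  have S: "fps_op \<phi> q = p \<and> poly q 0 = 0 \<longleftrightarrow> q = S p" for p q
    unfolding S_def using theI'[OF ex1_fps_op[OF assms, of p]] ex1_fps_op[OF assms, of p] by blast
  define u where "u = rec_nat 1 (\<lambda>n p. S (smult (of_nat (Suc n)) p))"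
  have char: "poweroids \<phi> v \<longleftrightarrow> v 0 = 1 \<and> (\<forall>n. v (Suc n) = S (smult (of_nat (Suc n)) (v n)))" for v
    unfolding poweroids_def S[symmetric]
    by (metis Suc_le_D One_nat_def diff_Suc_1 le_add1 plus_1_eq_Suc)
  show ?thesis
  proof (rule ex1I[of _ u])
    show "poweroids \<phi> u" by (simp add: char u_def)
  next
    fix v assume v: "poweroids \<phi> v"
    have "v n = u n" for n
      using v by (induction n) (simp_all add: char u_def)
    then show "v = u" by auto
  qed
qed

lemma theta_deriv_1:
  assumes "delta_series \<phi>"
  shows "theta_deriv \<phi> 1 f = fps_deriv f / fps_deriv \<phi>"
proof -
  have \<phi>: "\<phi> $ 0 = 0" "\<phi> $ 1 \<noteq> 0" using assms by (auto simp: delta_series_def)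
  have i0: "fps_inv \<phi> $ 0 = 0" by (simp add: fps_inv_def)
  have "f = (f oo fps_inv \<phi>) oo \<phi>"
    by (simp add: fps_compose_assoc[OF \<phi>(1) i0, symmetric] fps_inv[OF \<phi>])
  then have "fps_deriv f = (fps_deriv (f oo fps_inv \<phi>) oo \<phi>) * fps_deriv \<phi>"
    by (metis fps_compose_deriv \<phi>(1))
  moreover have "fps_deriv \<phi> $ 0 \<noteq> 0" using \<phi> by simp
  ultimately show ?thesis
    by (metis theta_deriv_def fps_nth_deriv.simps One_nat_def nonzero_mult_div_cancel_right fps_zero_nth)
qed

end

theory Submission
  imports Defs
begin

text \<open>Expand \<open>f\<close> in powers of \<open>\<theta>\<close>. As \<open>\<theta>\<close> lowers the index of the poweroids, \<open>\<theta>^k x^{n}\<close>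
  vanishes at \<open>0\<close> for \<open>k \<noteq> n\<close> and equals \<open>n!\<close> there for \<open>k = n\<close>. So if \<open>f = g(\<theta>)\<close>, then
  \<open>f(D) 0^{n}\<close> is \<open>n!\<close> times the \<open>n\<close>-th coefficient of \<open>g\<close>, that is, the constant coefficient of
  the \<open>n\<close>-th derivative of \<open>g\<close>.\<close>

lemma poly_fps_op_0_upto:
  assumes "degree p \<le> N"
  shows "poly (fps_op f p) 0 = (\<Sum>m\<le>N. f $ m * poly ((pderiv ^^ m) p) 0)"
  unfolding fps_op_upto[OF assms] by (simp add: poly_sum)

text \<open>Since \<open>\<phi> ^ i\<close> has no terms below index \<open>i\<close>, the
  coefficients of \<open>g oo \<phi>\<close> up to \<open>N\<close> involve only
  \<open>i \<le> N\<close>. This leaves a finite double sum, whose order can be swapped.\<close>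

lemma poly_fps_op_compose_0:
  fixes \<phi> :: "'a::field_char_0 fps"
  assumes "\<phi> $ 0 = 0" and "degree p \<le> N"
  shows "poly (fps_op (g oo \<phi>) p) 0 = (\<Sum>i\<le>N. g $ i * poly (fps_op (\<phi> ^ i) p) 0)"
proof -
  have nth: "(g oo \<phi>) $ m = (\<Sum>i\<le>N. g $ i * \<phi> ^ i $ m)" if "m \<le> N" for m
    unfolding fps_compose_nth atLeast0AtMost
    by (rule sum.mono_neutral_left)
      (use assms(1) that in \<open>auto simp: startsby_zero_power_prefix\<close>)
  have "poly (fps_op (g oo \<phi>) p) 0
      = (\<Sum>m\<le>N. \<Sum>i\<le>N. g $ i * (\<phi> ^ i $ m * poly ((pderiv ^^ m) p) 0))"
    unfolding poly_fps_op_0_upto[OF assms(2)]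
    by (intro sum.cong refl) (simp add: nth sum_distrib_right mult.assoc)
  also have "\<dots> = (\<Sum>i\<le>N. g $ i * poly (fps_op (\<phi> ^ i) p) 0)"
    unfolding poly_fps_op_0_upto[OF assms(2)] sum_distrib_left by (rule sum.swap)
  finally show ?thesis .
qed

lemma poly_fps_op_power_poweroid_0:
  assumes "delta_series \<phi>" and "poweroids \<phi> u"
  shows "poly (fps_op (\<phi> ^ k) (u n)) 0 = (if k = n then fact n else 0)"
proof (induction k arbitrary: n)
  case 0
  then show ?case using assms(2) by (cases n) (auto simp: poweroids_def)
next
  case (Suc k)
  show ?case
  proof (cases n)
    case 0
    \<comment> \<open>The constant \<open>u 0 = 1\<close> is killed because
      \<open>\<phi> $ 0 = 0\<close>.\<close>
    have "fps_op \<phi> (u 0) = 0"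
      using assms by (simp add: poweroids_def delta_series_def fps_op_def)
    moreover have "fps_op (\<phi> ^ k) 0 = 0" by (simp add: fps_op_def)
    ultimately show ?thesis using 0 by (simp add: power_Suc2 fps_op_mult del: power_Suc)
  next
    case (Suc m)
    have "fps_op \<phi> (u (Suc m)) = smult (of_nat (Suc m)) (u m)"
      using assms(2) by (simp add: poweroids_def)
    \<comment> \<open>\<open>power_Suc2\<close> lets one factor \<open>\<phi>\<close> act on the
      poweroid first; its factor \<open>Suc m\<close> turns \<open>fact m\<close> into
      \<open>fact (Suc m)\<close>.\<close>
    then show ?thesis
      using Suc Suc.IH[of m] by (simp add: power_Suc2 fps_op_mult fps_op_smult del: power_Suc)
  qed
qed

lemma poly_fps_op_compose_poweroid_0:
  assumes "delta_series \<phi>" and "poweroids \<phi> u"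
  shows "poly (fps_op (g oo \<phi>) (u n)) 0 = fact n * g $ n"
proof -
  \<comment> \<open>The bound covers both the truncation at the degree and the one surviving index
    \<open>n\<close>.\<close>
  let ?N = "max n (degree (u n))"
  have "poly (fps_op (g oo \<phi>) (u n)) 0 = (\<Sum>i\<le>?N. g $ i * poly (fps_op (\<phi> ^ i) (u n)) 0)"
    using assms(1) by (intro poly_fps_op_compose_0) (auto simp: delta_series_def)
  also have "\<dots> = (\<Sum>i\<le>?N. if i = n then fact n * g $ n else 0)"
    by (intro sum.cong refl) (simp add: poly_fps_op_power_poweroid_0[OF assms])
  also have "\<dots> = fact n * g $ n" by simp
  finally show ?thesis .
qed

text \<open>On the sequence \<open>fact n * g $ n\<close>, differentiation is the index shift.
  \<open>g\<close> varies in the induction because \<open>fps_nth_deriv\<close> applies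
  \<open>fps_deriv\<close> to its argument first.\<close>

lemma fact_mult_fps_nth_deriv_nth:
  fixes g :: "'a::field_char_0 fps"
  shows "fact n * fps_nth_deriv j g $ n = fact (n + j) * g $ (n + j)"
  by (induction j arbitrary: g) (simp_all add: algebra_simps)

theorem theoremD:
  fixes \<phi> f :: "'a::field_char_0 fps"
    and u :: "nat \<Rightarrow> 'a poly"
    and n :: nat
  assumes "delta_series \<phi>"
    and "poweroids \<phi> u"
    and "n \<ge> 1"
  shows "\<forall>j\<le>n. poly (fps_op f (u n)) 0 = poly (fps_op (theta_deriv \<phi> j f) (u (n - j))) 0"
proof (intro allI impI)
  fix j assume "j \<le> n"
  define g where "g = f oo fps_inv \<phi>"
  have \<phi>: "\<phi> $ 0 = 0" "\<phi> $ 1 \<noteq> 0" using assms(1) by (auto simp: delta_series_def)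
  have "fps_inv \<phi> $ 0 = 0" by (simp add: fps_inv_def)
  then have f: "f = g oo \<phi>"
    by (simp add: g_def fps_compose_assoc[OF \<phi>(1), symmetric] fps_inv[OF \<phi>])
  have "poly (fps_op f (u n)) 0 = fact n * g $ n"
    unfolding f by (rule poly_fps_op_compose_poweroid_0[OF assms(1,2)])
  also have "\<dots> = fact (n - j) * fps_nth_deriv j g $ (n - j)"
    using \<open>j \<le> n\<close> by (simp add: fact_mult_fps_nth_deriv_nth)
  \<comment> \<open>\<open>theta_deriv \<phi> j f\<close> is again a composite with
    \<open>\<phi>\<close>, so the same evaluation applies at index \<open>n - j\<close>.\<close>
  also have "\<dots> = poly (fps_op (theta_deriv \<phi> j f) (u (n - j))) 0"
    unfolding theta_deriv_def g_def[symmetric]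
    by (rule poly_fps_op_compose_poweroid_0[OF assms(1,2), symmetric])
  finally show "poly (fps_op f (u n)) 0 = poly (fps_op (theta_deriv \<phi> j f) (u (n - j))) 0" .
qed

end
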